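(* Let $S=\log$ be the natural logarithm, regarded as a maximally monotone operator on $\mathbb{R}$ with domain $\left]0,\infty\right[$. Then the largest representative function $\sigma_{\log}\colon\mathbb{R}\times\mathbb{R}\to\left]-\infty,+\infty\right]$ of $S$ is given by $$\sigma_{\log}(x,y)=\begin{cases} x\log(x) & \text{if } x>0 \text{ and } y\leq\log(x),\\ \infty & \text{otherwise.}\end{cases}$$
   Context: For a maximally monotone operator $S\colon X\rightrightarrows X^\ast$ with graph $\mathcal{G}(S)$ (here $X=X^\ast=\mathbb{R}$ and $\langle x,v\rangle=xv$), a function $h\colon X\times X^\ast\to\left]-\infty,+\infty\right]$ represents $S$, written $h\in\mathcal{H}(S)$, if (a) $h$ is convex and norm $\times$ weak$^\ast$ lower semicontinuous; (b) $h(x,v)\geq\langle x,v\rangle$ for all $(x,v)$; (c) $h(x,v)=\langle x,v\rangle$ if and only if $(x,v)\in\mathcal{G}(S)$. $\sigma_S$ denotes the largest (pointwise) member of $\mathcal{H}(S)$. It is known that it exists and that its epigraph is $\operatorname{epi}\sigma_S=\overline{\operatorname{co}}\,\operatorname{epi}(\pi+\iota_{\mathcal{G}(S)})$, the closed convex hull, where $\pi(p,p^\ast)=\langle p,p^\ast\rangle$ and $\iota_{\mathcal{G}(S)}$ is the indicator function ($0$ on $\mathcal{G}(S)$, $+\infty$ elsewhere). Here $\mathcal{G}(\log)=\{(z,\log z): z>0\}$. *)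

theory Defs
  imports "HOL-Analysis.Analysis"
begin

text \<open>
  Here \<open>X = X\<^sup>* = \<real>\<close> with pairing \<open>\<langle>x,v\<rangle> = x * v\<close>, so that the norm \<open>\<times>\<close> weak* topology on
  \<open>X \<times> X\<^sup>*\<close> is the usual topology of \<open>real \<times> real\<close>. A set-valued operator is a function into sets.
\<close>

definition gra :: "(real \<Rightarrow> real set) \<Rightarrow> (real \<times> real) set" where
  "gra S = {(x, v). v \<in> S x}"

definition monotone_op :: "(real \<Rightarrow> real set) \<Rightarrow> bool" where
  "monotone_op S \<longleftrightarrow> (\<forall>(x, u) \<in> gra S. \<forall>(y, v) \<in> gra S. (x - y) * (u - v) \<ge> 0)"

definition maximally_monotone :: "(real \<Rightarrow> real set) \<Rightarrow> bool" where
  "maximally_monotone S \<longleftrightarrow>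
     monotone_op S \<and> (\<forall>T. monotone_op T \<longrightarrow> gra S \<subseteq> gra T \<longrightarrow> gra T = gra S)"

text \<open>
  Only weights \<open>0 < u, v\<close> are used below, so that no product \<open>0 * \<infinity>\<close> occurs; no sum
  \<open>\<infinity> - \<infinity>\<close> occurs for the functions without value \<open>-\<infinity>\<close> considered here.
\<close>

definition convex_ext :: "('a::real_vector \<Rightarrow> ereal) \<Rightarrow> bool" where
  "convex_ext h \<longleftrightarrow>
     (\<forall>p q u v. 0 < u \<longrightarrow> 0 < v \<longrightarrow> u + v = 1 \<longrightarrow>
        h (u *\<^sub>R p + v *\<^sub>R q) \<le> ereal u * h p + ereal v * h q)"

definition lower_semicont :: "('a::topological_space \<Rightarrow> ereal) \<Rightarrow> bool" where
  "lower_semicont h \<longleftrightarrow> (\<forall>p. h p \<le> Liminf (at p) h)"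

definition representatives :: "(real \<Rightarrow> real set) \<Rightarrow> (real \<times> real \<Rightarrow> ereal) set" where
  "representatives S = {h.
     (\<forall>p. h p \<noteq> -\<infinity>) \<and>
     convex_ext h \<and> lower_semicont h \<and>
     (\<forall>x v. h (x, v) \<ge> ereal (x * v)) \<and>
     (\<forall>x v. h (x, v) = ereal (x * v) \<longleftrightarrow> (x, v) \<in> gra S)}"

text \<open>
  The order on functions is pointwise. For maximally monotone \<open>S\<close> the greatest element exists,
  see \<open>largest_representative\<close> below.
\<close>

definition sigma_rep :: "(real \<Rightarrow> real set) \<Rightarrow> real \<times> real \<Rightarrow> ereal" where
  "sigma_rep S = (GREATEST h. h \<in> representatives S)"

definition log_op :: "real \<Rightarrow> real set" where
  "log_op x = (if x > 0 then {ln x} else {})"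


lemma convex_ext_SUP:
  assumes "\<And>h. h \<in> A \<Longrightarrow> convex_ext h"
  shows "convex_ext (\<lambda>p. SUP h\<in>A. h p)"
  unfolding convex_ext_def
proof (intro allI impI SUP_least)
  fix p q :: 'a and u v :: real and h
  assume uv: "0 < u" "0 < v" "u + v = 1" and h: "h \<in> A"
  have "h (u *\<^sub>R p + v *\<^sub>R q) \<le> ereal u * h p + ereal v * h q"
    using assms[OF h] uv by (simp add: convex_ext_def)
  also have "\<dots> \<le> ereal u * (SUP h\<in>A. h p) + ereal v * (SUP h\<in>A. h q)"
    using uv h by (intro add_mono ereal_mult_left_mono SUP_upper) auto
  finally show "h (u *\<^sub>R p + v *\<^sub>R q) \<le> \<dots>" .
qed

lemma lower_semicont_SUP:
  assumes "\<And>h. h \<in> A \<Longrightarrow> lower_semicont h"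
  shows "lower_semicont (\<lambda>p. SUP h\<in>A. h p)"
  unfolding lower_semicont_def
proof (intro allI SUP_least)
  fix p h assume h: "h \<in> A"
  have "h p \<le> Liminf (at p) h"
    using assms[OF h] by (simp add: lower_semicont_def)
  also have "\<dots> \<le> Liminf (at p) (\<lambda>p. SUP h\<in>A. h p)"
    by (intro Liminf_mono always_eventually allI SUP_upper h)
  finally show "h p \<le> \<dots>" .
qed

lemma maximally_monotone_witness:
  assumes S: "maximally_monotone S" and xv: "(x, v) \<notin> gra S"
  obtains a b where "(a, b) \<in> gra S" "(x - a) * (v - b) < 0"
proof (rule ccontr)
  assume "\<not> thesis"
  with that have ge: "\<And>a b. (a, b) \<in> gra S \<Longrightarrow> (x - a) * (v - b) \<ge> 0"
    by (meson not_less)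
  define T where "T = S(x := insert v (S x))"
  have T: "gra T = insert (x, v) (gra S)"
    by (auto simp: gra_def T_def split: if_splits)
  have sym: "(a - x) * (b - v) = (x - a) * (v - b)" for a b
    by (simp add: algebra_simps)
  have "monotone_op T"
    using S ge by (auto simp: monotone_op_def maximally_monotone_def T sym)
  with S T have "gra T = gra S"
    by (auto simp: maximally_monotone_def)
  with T xv show False by auto
qed

lemma representatives_nonempty:
  assumes S: "maximally_monotone S"
  shows "representatives S \<noteq> {}"
proof -
  text \<open>The Fitzpatrick function is a representative.\<close>
  define g where "g = (\<lambda>(a, b) (x, v). ereal (x * b + a * v - a * b))"
  define F where "F = (\<lambda>p. SUP h\<in>g ` gra S. h p)"
  have up: "ereal (x * b + a * v - a * b) \<le> F (x, v)" if "(a, b) \<in> gra S" for a b x v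
    unfolding F_def using that by (intro SUP_upper2[of "g (a, b)"]) (auto simp: g_def)
  have on: "F (x, v) = ereal (x * v)" if "(x, v) \<in> gra S" for x v
  proof (rule antisym)
    show "F (x, v) \<le> ereal (x * v)"
      unfolding F_def
    proof (rule SUP_least, clarify)
      fix a b assume "(a, b) \<in> gra S"
      with S that have "(x - a) * (v - b) \<ge> 0"
        by (auto simp: maximally_monotone_def monotone_op_def)
      then show "g (a, b) (x, v) \<le> ereal (x * v)"
        by (simp add: g_def algebra_simps)
    qed
    show "ereal (x * v) \<le> F (x, v)"
      using up[OF that, of x v] by (simp add: algebra_simps)
  qed
  have off: "ereal (x * v) < F (x, v)" if xv: "(x, v) \<notin> gra S" for x v
  proof -
    obtain a b where ab: "(a, b) \<in> gra S" "(x - a) * (v - b) < 0"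
      using maximally_monotone_witness[OF S xv] .
    then have "ereal (x * v) < ereal (x * b + a * v - a * b)"
      by (simp add: algebra_simps)
    also note up[OF ab(1)]
    finally show ?thesis .
  qed
  have ge: "ereal (x * v) \<le> F (x, v)" for x v
    using on off by (metis order.refl less_imp_le)
  have cv: "convex_ext F"
    unfolding F_def
  proof (rule convex_ext_SUP, clarify)
    fix a b
    show "convex_ext (g (a, b))"
      unfolding convex_ext_def
    proof (intro allI impI)
      fix p q :: "real \<times> real" and u v :: real assume "u + v = 1"
      then have u: "u = 1 - v" by simp
      show "g (a, b) (u *\<^sub>R p + v *\<^sub>R q) \<le> ereal u * g (a, b) p + ereal v * g (a, b) q"
        by (cases p; cases q) (simp add: g_def u algebra_simps)
    qed
  qed
  have lsc: "lower_semicont F"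
    unfolding F_def
  proof (rule lower_semicont_SUP, clarify)
    fix a b
    have "(g (a, b) \<longlongrightarrow> g (a, b) p) (at p)" for p
      unfolding g_def case_prod_beta by (intro tendsto_intros)
    then have "Liminf (at p) (g (a, b)) = g (a, b) p" for p
      by (intro lim_imp_Liminf) (auto simp: trivial_limit_at)
    then show "lower_semicont (g (a, b))"
      by (simp add: lower_semicont_def)
  qed
  have "F p \<noteq> -\<infinity>" for p
    using ge[of "fst p" "snd p"] by auto
  moreover have "F (x, v) = ereal (x * v) \<longleftrightarrow> (x, v) \<in> gra S" for x v
    using on off by (metis less_irrefl)
  ultimately have "F \<in> representatives S"
    unfolding representatives_def using cv lsc ge by auto
  then show ?thesis by blast
qed

lemma largest_representative:
  assumes S: "maximally_monotone S"
  shows "sigma_rep S \<in> representatives S"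
    and "\<And>h. h \<in> representatives S \<Longrightarrow> h \<le> sigma_rep S"
proof -
  define s where "s = (\<lambda>p. SUP h\<in>representatives S. h p)"
  obtain f where f: "f \<in> representatives S"
    using representatives_nonempty[OF S] by blast
  have up: "h p \<le> s p" if "h \<in> representatives S" for h p
    unfolding s_def using that by (rule SUP_upper)
  have on: "s (x, v) = ereal (x * v)" if xv: "(x, v) \<in> gra S" for x v
  proof -
    have eq: "h (x, v) = ereal (x * v)" if "h \<in> representatives S" for h
      using that xv by (auto simp: representatives_def)
    show ?thesis
    proof (rule antisym)
      show "s (x, v) \<le> ereal (x * v)"
        unfolding s_def by (rule SUP_least) (simp add: eq)
      show "ereal (x * v) \<le> s (x, v)"
        using up[OF f, of "(x, v)"] eq[OF f] by simp
    qed
  qed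
  have ge: "ereal (x * v) \<le> f (x, v)" for x v
    using f by (auto simp: representatives_def)
  have ge': "ereal (x * v) \<le> s (x, v)" for x v
    using ge up[OF f] by (rule order_trans)
  have off: "(x, v) \<in> gra S" if "s (x, v) = ereal (x * v)" for x v
  proof -
    have "f (x, v) = ereal (x * v)"
      using ge[of x v] up[OF f, of "(x, v)"] that by simp
    then show ?thesis using f by (auto simp: representatives_def)
  qed
  have "s p \<noteq> -\<infinity>" for p
    using ge'[of "fst p" "snd p"] by auto
  moreover have "convex_ext s" "lower_semicont s"
    unfolding s_def
    by (auto intro!: convex_ext_SUP lower_semicont_SUP simp: representatives_def)
  ultimately have s: "s \<in> representatives S"
    unfolding representatives_def using ge' on off by auto
  have "sigma_rep S = s"
    unfolding sigma_rep_def using s up by (intro Greatest_equality) (auto simp: le_fun_def)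
  with s up show "sigma_rep S \<in> representatives S"
    and "\<And>h. h \<in> representatives S \<Longrightarrow> h \<le> sigma_rep S"
    by (auto simp: le_fun_def)
qed

lemma maximally_monotone_log_op: "maximally_monotone log_op"
  unfolding maximally_monotone_def
proof (intro conjI allI impI)
  have gra: "(x, v) \<in> gra log_op \<longleftrightarrow> x > 0 \<and> v = ln x" for x v
    by (auto simp: gra_def log_op_def)
  show "monotone_op log_op"
    unfolding monotone_op_def
  proof clarify
    fix x u y v assume "(x, u) \<in> gra log_op" "(y, v) \<in> gra log_op"
    then have *: "x > 0" "y > 0" "u = ln x" "v = ln y" by (auto simp: gra)
    show "0 \<le> (x - y) * (u - v)"
      using * by (cases "x \<le> y") (auto intro: mult_nonpos_nonpos mult_nonneg_nonneg)
  qed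
  fix T assume T: "monotone_op T" and sub: "gra log_op \<subseteq> gra T"
  show "gra T = gra log_op"
  proof (rule antisym[OF _ sub], clarify)
    fix x v assume xv: "(x, v) \<in> gra T"
    have mon: "0 \<le> (x - z) * (v - ln z)" if "z > 0" for z
    proof -
      have "(z, ln z) \<in> gra T" using sub that by (auto simp: subset_iff gra)
      with T xv show ?thesis by (fastforce simp: monotone_op_def)
    qed
    have le: "v \<le> ln z" if "z > 0" "x < z" for z
      using mon[OF that(1)] that by (simp add: zero_le_mult_iff)
    have ge: "ln z \<le> v" if "z > 0" "z < x" for z
      using mon[OF that(1)] that by (simp add: zero_le_mult_iff)
    have pos: "x > 0"
    proof (rule ccontr)
      assume "\<not> x > 0"
      then have "v \<le> ln (exp (v - 1))" by (intro le) (auto intro: le_less_trans[of _ 0])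
      then show False by simp
    qed
    have "exp v \<le> x"
    proof (rule dense_ge)
      fix z assume "x < z"
      with le[of z] pos show "exp v \<le> z" by (simp add: ln_ge_iff)
    qed
    moreover have "x \<le> exp v"
    proof (rule dense_le_bounded[OF pos])
      fix z assume "0 < z" "z < x"
      with ge[of z] show "z \<le> exp v" by (metis exp_le_cancel_iff exp_ln)
    qed
    ultimately have "x = exp v" by simp
    then show "(x, v) \<in> gra log_op" by (simp add: gra)
  qed
qed

end

theory Submission
  imports Defs
begin

text \<open>
  Write \<open>h\<close> for the right-hand side. Its domain is the closed convex set \<open>exp y \<le> x\<close>, on which
  \<open>x ln x\<close> is convex and continuous, and so \<open>h\<close> is a representative of \<open>ln\<close>. Conversely, let \<open>s\<close> be
  a representative and \<open>c = ln x - y \<ge> 0\<close>. The convex combination of the graph points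
  \<open>(exp (- n c), - n c)\<close> and \<open>(x, ln x)\<close> with weights \<open>1/n\<close> and \<open>1 - 1/n\<close> tends to \<open>(x, y)\<close>,
  while the bound that convexity gives for \<open>s\<close> there tends to \<open>x ln x\<close>. Hence \<open>s \<le> h\<close>.
\<close>

text \<open>If \<open>l < c < h a\<close>, then \<open>h\<close> exceeds \<open>c\<close> on a whole
  neighbourhood of \<open>a\<close>, while the bounds \<open>v n\<close> eventually fall below
  \<open>c\<close>.\<close>

lemma lower_semicont_le_limit:
  fixes h :: "'a::topological_space \<Rightarrow> ereal"
  assumes h: "lower_semicont h" and p: "p \<longlonglongrightarrow> a" and v: "v \<longlonglongrightarrow> l"
    and le: "\<forall>\<^sub>F n in sequentially. h (p n) \<le> v n"
  shows "h a \<le> l"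
proof (rule ccontr)
  assume "\<not> h a \<le> l"
  then obtain c where c: "l < c" "c < h a"
    using dense[of l "h a"] by (auto simp: not_le)
  have "c < Liminf (at a) h"
    using c(2) h unfolding lower_semicont_def by (metis less_le_trans)
  then have "\<forall>\<^sub>F q in at a. c < h q"
    by (rule less_LiminfD)
  \<comment> \<open>The filter \<open>at a\<close> omits \<open>a\<close> itself;
    \<open>c < h a\<close> supplies that point, since some \<open>p n\<close> may equal
    \<open>a\<close>.\<close>
  with c(2) have "\<forall>\<^sub>F q in nhds a. c < h q"
    by (auto simp: eventually_at_filter elim: eventually_mono)
  then have "\<forall>\<^sub>F n in sequentially. c < h (p n)"
    using p by (rule eventually_compose_filterlim)
  moreover have "\<forall>\<^sub>F n in sequentially. v n < c"
    using v c(1) by (rule order_tendstoD)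
  ultimately have "\<forall>\<^sub>F n in sequentially. False"
    using le by eventually_elim auto
  then show False by simp
qed

text \<open>Near a point of \<open>C\<close>, continuity controls the values on \<open>C\<close>,
  and those off \<open>C\<close> are infinite. A point off \<open>C\<close> has a neighbourhood
  avoiding \<open>C\<close>, as \<open>C\<close> is closed.\<close>

lemma lower_semicont_extend_infinity:
  fixes f :: "'a::t2_space \<Rightarrow> real"
  assumes C: "closed C" and f: "\<And>p. p \<in> C \<Longrightarrow> isCont f p"
  shows "lower_semicont (\<lambda>p. if p \<in> C then ereal (f p) else \<infinity>)"
  unfolding lower_semicont_def
proof
  fix p
  let ?h = "\<lambda>p. if p \<in> C then ereal (f p) else \<infinity>"
  show "?h p \<le> Liminf (at p) ?h"
    unfolding le_Liminf_iff
  proof (intro allI impI)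
    fix c assume c: "c < ?h p"
    show "\<forall>\<^sub>F q in at p. c < ?h q"
    proof (cases "p \<in> C")
      case True
      with f have "((\<lambda>q. ereal (f q)) \<longlongrightarrow> ereal (f p)) (at p)"
        by (simp add: isCont_def)
      moreover have "c < ereal (f p)" using c True by simp
      ultimately have "\<forall>\<^sub>F q in at p. c < ereal (f q)"
        by (rule order_tendstoD)
      then show ?thesis
        by eventually_elim (auto intro: less_le_trans)
    next
      case False
      with C have "\<forall>\<^sub>F q in at p. q \<in> - C"
        by (intro eventually_at_in_open') auto
      then show ?thesis
        by eventually_elim (use c False in auto)
    qed
  qed
qed

text \<open>The left-hand side is the tangent at \<open>m\<close> of the function
  \<open>x * ln x\<close>. The bound is \<open>ln t \<le> t - 1\<close> at \<open>t = m / x\<close>,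
  multiplied by \<open>x\<close>.\<close>

lemma mult_ln_tangent_le:
  fixes x m :: real
  assumes "x > 0" "m > 0"
  shows "x * ln m + x - m \<le> x * ln x"
proof -
  have "ln (m / x) \<le> m / x - 1"
    using assms by (intro ln_le_minus_one) simp
  then have "x * (ln m - ln x) \<le> x * (m / x - 1)"
    using assms by (intro mult_left_mono) (auto simp: ln_div)
  also have "\<dots> = m - x"
    using assms by (simp add: field_simps)
  finally show ?thesis by (simp add: algebra_simps)
qed

text \<open>The tangent at the convex combination \<open>m\<close> bounds the function from below at
  both \<open>x\<close> and \<open>z\<close>; averaging the two bounds gives the value at
  \<open>m\<close>.\<close>

lemma convex_on_mult_ln: "convex_on {0<..} (\<lambda>x::real. x * ln x)"
proof (rule convex_onI)
  fix t x z :: real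
  assume t: "0 < t" "t < 1" and xz: "x \<in> {0<..}" "z \<in> {0<..}"
  define m where "m = (1 - t) * x + t * z"
  have m: "m > 0"
    unfolding m_def using t xz by (intro add_pos_pos mult_pos_pos) auto
  have "(1 - t) * (x * ln m + x - m) + t * (z * ln m + z - m)
      \<le> (1 - t) * (x * ln x) + t * (z * ln z)"
    using t xz m by (intro add_mono mult_left_mono mult_ln_tangent_le) auto
  moreover have "(1 - t) * (x * ln m + x - m) + t * (z * ln m + z - m) = m * ln m + m - m"
    unfolding m_def by (simp add: algebra_simps)
  ultimately show "((1 - t) *\<^sub>R x + t *\<^sub>R z) * ln ((1 - t) *\<^sub>R x + t *\<^sub>R z)
      \<le> (1 - t) * (x * ln x) + t * (z * ln z)"
    by (simp add: m_def)
qed simp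

lemma convex_ext_extend_infinity:
  fixes f :: "'a::real_vector \<Rightarrow> real"
  assumes f: "convex_on C f"
  shows "convex_ext (\<lambda>p. if p \<in> C then ereal (f p) else \<infinity>)"
  unfolding convex_ext_def
proof (intro allI impI)
  fix p q :: 'a and u v :: real
  assume uv: "0 < u" "0 < v" "u + v = 1"
  let ?h = "\<lambda>p. if p \<in> C then ereal (f p) else \<infinity>"
  show "?h (u *\<^sub>R p + v *\<^sub>R q) \<le> ereal u * ?h p + ereal v * ?h q"
  proof (cases "p \<in> C \<and> q \<in> C")
    case True
    then have "u *\<^sub>R p + v *\<^sub>R q \<in> C"
      using f uv by (intro convexD) (auto simp: convex_on_def)
    moreover have "f (u *\<^sub>R p + v *\<^sub>R q) \<le> u * f p + v * f q"
      using f uv True by (auto simp: convex_on_def)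
    ultimately show ?thesis using True by simp
  next
    case False
    then show ?thesis using uv by auto
  qed
qed

text \<open>Up to swapping coordinates this is the epigraph of the convex function
  \<open>exp\<close>.\<close>

lemma convex_exp_epigraph: "convex {p :: real \<times> real. exp (snd p) \<le> fst p}"
proof (rule convexI)
  fix p q :: "real \<times> real" and u v :: real
  assume p: "p \<in> {p. exp (snd p) \<le> fst p}" and q: "q \<in> {p. exp (snd p) \<le> fst p}"
    and uv: "0 \<le> u" "0 \<le> v" "u + v = 1"
  have "exp (u * snd p + v * snd q) \<le> u * exp (snd p) + v * exp (snd q)"
    using exp_convex uv by (auto simp: convex_on_def)
  also have "\<dots> \<le> u * fst p + v * fst q"
    using p q uv by (intro add_mono mult_left_mono) auto
  finally show "u *\<^sub>R p + v *\<^sub>R q \<in> {p. exp (snd p) \<le> fst p}" by simp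
qed

text \<open>In the form \<open>exp y \<le> x\<close> the domain is visibly closed and convex, and
  \<open>x > 0\<close> is implied.\<close>

definition log_rep :: "real \<times> real \<Rightarrow> ereal" where
  "log_rep p = (if p \<in> {p. exp (snd p) \<le> fst p} then ereal (fst p * ln (fst p)) else \<infinity>)"

lemma exp_le_iff_le_ln: "exp y \<le> x \<longleftrightarrow> x > 0 \<and> y \<le> ln x" for x y :: real
  by (metis exp_gt_zero less_le_trans ln_ge_iff)

lemma log_rep_in_representatives: "log_rep \<in> representatives log_op"
proof -
  have "convex_on {p :: real \<times> real. exp (snd p) \<le> fst p} (\<lambda>p. fst p * ln (fst p))"
    unfolding convex_on_def
  proof (intro conjI convex_exp_epigraph ballI allI impI)
    fix p q :: "real \<times> real" and u v :: real
    assume *: "p \<in> {p. exp (snd p) \<le> fst p}" "q \<in> {p. exp (snd p) \<le> fst p}"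
      "0 \<le> u" "0 \<le> v" "u + v = 1"
    then have "fst p > 0" "fst q > 0" by (simp_all add: exp_le_iff_le_ln)
    then show "fst (u *\<^sub>R p + v *\<^sub>R q) * ln (fst (u *\<^sub>R p + v *\<^sub>R q))
        \<le> u * (fst p * ln (fst p)) + v * (fst q * ln (fst q))"
      using convex_on_mult_ln * by (simp add: convex_on_def)
  qed
  then have "convex_ext log_rep"
    unfolding log_rep_def by (rule convex_ext_extend_infinity)
  moreover have "lower_semicont log_rep"
    unfolding log_rep_def
  proof (rule lower_semicont_extend_infinity)
    show "closed {p :: real \<times> real. exp (snd p) \<le> fst p}"
      by (intro closed_Collect_le continuous_intros)
    fix p :: "real \<times> real" assume "p \<in> {p. exp (snd p) \<le> fst p}"
    then have "fst p \<noteq> 0" by (simp add: exp_le_iff_le_ln)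
    then show "isCont (\<lambda>p. fst p * ln (fst p)) p" by (intro continuous_intros)
  qed
  moreover have "ereal (x * v) \<le> log_rep (x, v)" for x v
    by (auto simp: log_rep_def exp_le_iff_le_ln)
  moreover have "log_rep (x, v) = ereal (x * v) \<longleftrightarrow> (x, v) \<in> gra log_op" for x v
    by (auto simp: log_rep_def exp_le_iff_le_ln gra_def log_op_def)
  moreover have "log_rep p \<noteq> -\<infinity>" for p
    by (simp add: log_rep_def)
  ultimately show ?thesis by (simp add: representatives_def)
qed

lemma representative_log_op_le:
  assumes s: "s \<in> representatives log_op" and x: "x > 0" and y: "y \<le> ln x"
  shows "s (x, y) \<le> ereal (x * ln x)"
proof -
  have on: "s (z, ln z) = ereal (z * ln z)" if "z > 0" for z
    using s that by (auto simp: representatives_def gra_def log_op_def)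
  show ?thesis
  \<comment> \<open>For \<open>y = ln x\<close> the gap \<open>c\<close> would vanish and
    \<open>e n\<close> would be constantly 1 instead of tending to 0.\<close>
  proof (cases "y = ln x")
    case True
    with on[OF x] show ?thesis by simp
  next
    case False
    define c where "c = ln x - y"
    with False y have c: "c > 0" by simp
    define w :: "nat \<Rightarrow> real" where "w = (\<lambda>n. 1 / real n)"
    define e where "e = (\<lambda>n. exp (- (real n * c)))"
    \<comment> \<open>The far graph point has second coordinate \<open>- n * c\<close> and weight
      \<open>1 / n\<close>, so it lowers the second coordinate by exactly \<open>c\<close>. Its
      share of the bound is only \<open>- c * e n\<close>, which tends to 0.\<close>
    define p where "p = (\<lambda>n. (w n * e n + (1 - w n) * x, (1 - w n) * ln x - c))"
    define v where "v = (\<lambda>n. ereal ((1 - w n) * (x * ln x) - c * e n))"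
    have w: "w \<longlonglongrightarrow> 0"
      unfolding w_def by (rule lim_1_over_n)
    have "filterlim (\<lambda>n. real n * c) at_top sequentially"
      using c by (intro filterlim_at_top_mult_tendsto_pos[OF tendsto_const] filterlim_real_sequentially)
    then have e: "e \<longlonglongrightarrow> 0"
      unfolding e_def
      by (intro filterlim_compose[OF exp_at_bot] filterlim_compose[OF filterlim_uminus_at_bot_at_top])
    have "p \<longlonglongrightarrow> (0 * 0 + (1 - 0) * x, (1 - 0) * ln x - c)"
      unfolding p_def by (intro tendsto_intros w e)
    then have "p \<longlonglongrightarrow> (x, y)"
      by (simp add: c_def)
    moreover have "v \<longlonglongrightarrow> ereal ((1 - 0) * (x * ln x) - c * 0)"
      unfolding v_def by (intro tendsto_intros w e)
    then have "v \<longlonglongrightarrow> ereal (x * ln x)"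
      by simp
    moreover have "\<forall>\<^sub>F n in sequentially. s (p n) \<le> v n"
      \<comment> \<open>At \<open>n = 1\<close> the weight \<open>1 - w n\<close> is 0, but
        \<open>convex_ext\<close> speaks of positive weights only.\<close>
      using eventually_gt_at_top[of 1]
    proof eventually_elim
      case (elim n)
      have wn: "0 < w n" "0 < 1 - w n" "w n * (real n * z) = z" for z
        using elim by (auto simp: w_def)
      have "p n = w n *\<^sub>R (e n, ln (e n)) + (1 - w n) *\<^sub>R (x, ln x)"
        using wn(3)[of c] by (simp add: p_def e_def)
      also have "s \<dots> \<le> ereal (w n) * s (e n, ln (e n)) + ereal (1 - w n) * s (x, ln x)"
        using s wn by (auto simp: representatives_def convex_ext_def)
      also have "\<dots> = ereal (w n * (e n * ln (e n)) + (1 - w n) * (x * ln x))"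
        using on[of "e n"] on[OF x] by (simp add: e_def)
      also have "w n * (e n * ln (e n)) = - (c * e n)"
        using wn(3)[of "c * e n"] by (simp add: e_def mult_ac)
      finally show ?case by (simp add: v_def)
    qed
    moreover have "lower_semicont s"
      using s by (simp add: representatives_def)
    ultimately show ?thesis
      by (blast intro: lower_semicont_le_limit)
  qed
qed

theorem theorem3p3:
  fixes x y :: real
  shows "sigma_rep log_op (x, y) =
    (if x > 0 \<and> y \<le> ln x then ereal (x * ln x) else \<infinity>)"
proof -
  note largest = largest_representative[OF maximally_monotone_log_op]
  \<comment> \<open>Off the domain this lower bound already forces the value infinity; on it, the
    upper bound for representatives matches.\<close>
  have "log_rep (x, y) \<le> sigma_rep log_op (x, y)"
    using largest(2)[OF log_rep_in_representatives] by (rule le_funD)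
  with representative_log_op_le[OF largest(1), of x y] show ?thesis
    by (auto simp: log_rep_def exp_le_iff_le_ln intro: antisym)
qed

end
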